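(* Let $\mathscr{R}$ be a commutative unitary ring, let $q\ge 2$ be an integer, let $\varepsilon\in\{1,-1\}$, and let $a_0,a_1,\dots,a_{q-1}\in\mathscr{R}$ be such that $\sum_{0\le j<q}a_j^2=1$ and $1+\varepsilon a_0$ is a unit of $\mathscr{R}$. Let $\mathsf{L}=(a_1\ a_2\ \cdots\ a_{q-1})$ be the corresponding $1\times(q-1)$ row matrix. Then the $q\times q$ matrix $$\mathsf{U}_\varepsilon=\begin{pmatrix} a_0 & \mathsf{L}\\ -\varepsilon\,{}^{\mathsf t}\mathsf{L} & \mathsf{I}-(1+\varepsilon a_0)^{-1}\,{}^{\mathsf t}\mathsf{L}\,\mathsf{L}\end{pmatrix}$$ satisfies ${}^{\mathsf t}\mathsf{U}_\varepsilon\,\mathsf{U}_\varepsilon=\mathsf{I}$.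
   Context: ${}^{\mathsf t}\mathsf{M}$ denotes the transpose of a matrix $\mathsf{M}$, and $\mathsf{I}$ denotes the identity matrix of the appropriate size (size $q-1$ in the lower right block of $\mathsf{U}_\varepsilon$, size $q$ in the conclusion). *)

theory Defs
  imports "Jordan_Normal_Form.Matrix"
begin

(* The sort {comm_ring, comm_monoid_mult} is that of commutative unitary rings
   in which 0 = 1 is allowed; every type of class comm_ring_1 has this sort. *)

definition unit_inv :: "'a::comm_monoid_mult \<Rightarrow> 'a" where
  "unit_inv x = (THE y. x * y = 1)"

lemma unit_inv_unique:
  fixes x y :: "'a::comm_monoid_mult"
  assumes "x * y = 1"
  shows "unit_inv x = y"
  unfolding unit_inv_def
proof (rule the_equality)
  fix z assume z: "x * z = 1"
  have "z = (x * y) * z" using assms by simp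
  also have "\<dots> = (x * z) * y" by (simp only: ac_simps)
  finally show "z = y" using z by simp
qed (fact assms)

lemma unit_inv_right:
  fixes x :: "'a::{comm_ring, comm_monoid_mult}"
  assumes "x dvd 1"
  shows "x * unit_inv x = 1"
  using assms by (metis dvdE unit_inv_unique)

definition row_L :: "nat \<Rightarrow> (nat \<Rightarrow> 'a) \<Rightarrow> 'a mat" where
  "row_L q a = mat 1 (q - 1) (\<lambda>(i, j). a (j + 1))"

definition mat_U :: "nat \<Rightarrow> 'a \<Rightarrow> (nat \<Rightarrow> 'a) \<Rightarrow> 'a::{comm_ring, comm_monoid_mult} mat" where
  "mat_U q \<epsilon> a =
     four_block_mat
       (mat 1 1 (\<lambda>_. a 0))
       (row_L q a)
       ((- \<epsilon>) \<cdot>\<^sub>m transpose_mat (row_L q a))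
       (1\<^sub>m (q - 1) - unit_inv (1 + \<epsilon> * a 0) \<cdot>\<^sub>m (transpose_mat (row_L q a) * row_L q a))"

end

theory Submission
  imports Defs
begin

text \<open>
  Write \<open>d = 1 + \<epsilon> a\<^sub>0\<close>, \<open>u = d\<^sup>-\<^sup>1\<close> and \<open>S = a\<^sub>1\<^sup>2 + \<dots> + a\<^sub>q\<^sub>-\<^sub>1\<^sup>2 = L L\<^sup>T\<close>.
  Since \<open>\<epsilon>\<^sup>2 = 1\<close>, the normalisation of \<open>a\<close> gives
  \<open>S = 1 - a\<^sub>0\<^sup>2 = d (1 - \<epsilon> a\<^sub>0)\<close>, so that \<open>u S = 1 - \<epsilon> a\<^sub>0 = 2 - d\<close>, a form in which no
  division remains (lemma \<open>inverse_times_tail\<close>).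

  The matrix \<open>I - u L\<^sup>T L\<close> acts as the identity up to a multiple of \<open>L\<close>, so each block of
  \<open>U\<^sup>T U\<close> differs from that of the identity by a scalar combination of these data:
  the corner is \<open>a\<^sub>0\<^sup>2 + \<epsilon>\<^sup>2 S = 1\<close>, the border is \<open>(a\<^sub>0 - \<epsilon> (1 - u S)) L = 0\<close>, and the
  remaining block is \<open>I + (1 - 2 u + u\<^sup>2 S) L\<^sup>T L\<close>, whose last coefficient vanishes because
  \<open>u (u S) = u (2 - d) = 2 u - 1\<close>.

  The ring may be trivial, so it is not an instance of a class with \<open>0 \<noteq> 1\<close>, which the
  algebraic laws of the identity matrix presuppose.  The blocks are therefore computed entry
  by entry, with the identity matrix appearing as a Kronecker delta under the sums.
\<close>

lemma mat_U_index:
  fixes \<epsilon> :: "'a::{comm_ring, comm_monoid_mult}"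
  assumes "i < q" and "j < q"
  shows "mat_U q \<epsilon> a $$ (i, j) =
    (if i = 0 then a j
     else if j = 0 then - (\<epsilon> * a i)
     else (if i = j then 1 else 0) - unit_inv (1 + \<epsilon> * a 0) * a i * a j)"
  using assms
  by (auto simp: mat_U_def row_L_def scalar_prod_def mult.assoc)

lemma mat_U_dim:
  assumes "q \<ge> 1"
  shows "dim_row (mat_U q \<epsilon> a) = q" and "dim_col (mat_U q \<epsilon> a) = q"
  using assms by (simp_all add: mat_U_def row_L_def)

text \<open>
  This is the action of \<open>I - u L\<^sup>T L\<close> on a column \<open>f\<close>: the only new scalar to evaluate is
  the product of \<open>L\<close> with \<open>f\<close>.
\<close>

lemma sum_delta_minus_mult:
  fixes a :: "nat \<Rightarrow> 'a::{comm_ring, comm_monoid_mult}"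
  assumes "finite K" and "i \<in> K"
  shows "(\<Sum>k\<in>K. ((if k = i then 1 else 0) - u * a k * a i) * f k)
       = f i - u * a i * (\<Sum>k\<in>K. a k * f k)"
proof -
  have "(\<Sum>k\<in>K. ((if k = i then 1 else 0) - u * a k * a i) * f k)
      = (\<Sum>k\<in>K. (if k = i then f k else 0) - u * a i * (a k * f k))"
    by (rule sum.cong) (auto simp: algebra_simps)
  then show ?thesis
    using assms by (simp add: sum_subtractf sum_distrib_left)
qed

text \<open>
  The factorisation \<open>1 - x\<^sup>2 = (1 + \<epsilon> x) (1 - \<epsilon> x)\<close> lets the inverse \<open>u\<close> of the
  first factor cancel.
\<close>

lemma inverse_times_tail:
  fixes \<epsilon> :: "'a::{comm_ring, comm_monoid_mult}"
  assumes "\<epsilon> * \<epsilon> = 1" and "x * x + S = 1" and "(1 + \<epsilon> * x) * u = 1"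
  shows "u * S = 1 - \<epsilon> * x"
proof -
  have "(1 + \<epsilon> * x) * (1 - \<epsilon> * x) = 1 - (\<epsilon> * \<epsilon>) * (x * x)"
    by (simp add: algebra_simps)
  also have "\<dots> = S"
    using assms(1,2) by (simp add: algebra_simps)
  finally have "S = (1 + \<epsilon> * x) * (1 - \<epsilon> * x)" ..
  then have "u * S = ((1 + \<epsilon> * x) * u) * (1 - \<epsilon> * x)"
    by (simp only: ac_simps)
  then show ?thesis
    using assms(3) by simp
qed

theorem mainTheorem2:
  fixes q :: nat
    and \<epsilon> :: "'a::{comm_ring, comm_monoid_mult}"
    and a :: "nat \<Rightarrow> 'a"
  assumes "q \<ge> 2"
    and "\<epsilon> \<in> {1, - 1}"
    and "(\<Sum>j<q. (a j)\<^sup>2) = 1"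
    and "(1 + \<epsilon> * a 0) dvd 1"
  shows "transpose_mat (mat_U q \<epsilon> a) * mat_U q \<epsilon> a = 1\<^sub>m q"
proof -
  define u where "u = unit_inv (1 + \<epsilon> * a 0)"
  define K where "K = {1..<q}"
  define S where "S = (\<Sum>k\<in>K. a k * a k)"
  define U where "U = mat_U q \<epsilon> a"
  have split: "(\<Sum>k\<in>{0..<q}. f k) = f 0 + (\<Sum>k\<in>K. f k)" for f :: "nat \<Rightarrow> 'a"
    using assms(1) by (simp add: K_def sum.atLeast_Suc_lessThan)
  have eps: "\<epsilon> * \<epsilon> = 1"
    using assms(2) by auto
  have norm: "a 0 * a 0 + S = 1"
    using assms(3) split[of "\<lambda>k. a k * a k"]
    by (simp add: S_def power2_eq_square lessThan_atLeast0)
  have inv: "(1 + \<epsilon> * a 0) * u = 1"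
    unfolding u_def by (rule unit_inv_right) (fact assms(4))
  have uS: "u * S = 1 - \<epsilon> * a 0"
    by (rule inverse_times_tail[OF eps norm inv])
  have fin: "finite K"
    by (simp add: K_def)
  have dims: "dim_row U = q" "dim_col U = q"
    using assms(1) mat_U_dim[of q] by (simp_all add: U_def)
  have top: "U $$ (0, j) = a j" if "j < q" for j
    using that assms(1) by (simp add: U_def mat_U_index)
  have left: "U $$ (k, 0) = - (\<epsilon> * a k)" if "k \<in> K" for k
    using that by (simp add: U_def K_def mat_U_index)
  have inner: "U $$ (k, j) = (if k = j then 1 else 0) - u * a k * a j"
    if "k \<in> K" "j \<in> K" for k j
    using that by (simp add: U_def K_def mat_U_index u_def)
  have gram: "(U\<^sup>T * U) $$ (i, j) = a i * a j + (\<Sum>k\<in>K. U $$ (k, i) * U $$ (k, j))"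
    if "i < q" "j < q" for i j
    using that dims by (simp add: scalar_prod_def split top)
  have corner: "(\<Sum>k\<in>K. U $$ (k, 0) * U $$ (k, 0)) = S"
  proof -
    have "(\<Sum>k\<in>K. U $$ (k, 0) * U $$ (k, 0)) = (\<Sum>k\<in>K. (\<epsilon> * \<epsilon>) * (a k * a k))"
      by (rule sum.cong) (simp_all add: left ac_simps)
    then show ?thesis by (simp add: eps S_def)
  qed
  have border: "(\<Sum>k\<in>K. U $$ (k, i) * U $$ (k, 0)) = - (a 0 * a i)" if i: "i \<in> K" for i
  proof -
    have "(\<Sum>k\<in>K. U $$ (k, i) * U $$ (k, 0))
        = (\<Sum>k\<in>K. ((if k = i then 1 else 0) - u * a k * a i) * (- (\<epsilon> * a k)))"
      by (rule sum.cong) (simp_all add: left inner i)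
    also have "\<dots> = - (\<epsilon> * a i) - u * a i * (\<Sum>k\<in>K. a k * (- (\<epsilon> * a k)))"
      by (rule sum_delta_minus_mult[OF fin i])
    also have "(\<Sum>k\<in>K. a k * (- (\<epsilon> * a k))) = - (\<epsilon> * S)"
      by (simp add: S_def sum_distrib_left sum_negf ac_simps)
    also have "- (\<epsilon> * a i) - u * a i * (- (\<epsilon> * S)) = \<epsilon> * a i * (u * S) - \<epsilon> * a i"
      by (simp add: algebra_simps)
    also have "\<dots> = - ((\<epsilon> * \<epsilon>) * (a 0 * a i))"
      unfolding uS by (simp add: algebra_simps)
    finally show ?thesis by (simp add: eps)
  qed
  have block: "(\<Sum>k\<in>K. U $$ (k, i) * U $$ (k, j)) = (if i = j then 1 else 0) - a i * a j"
    if i: "i \<in> K" and j: "j \<in> K" for i j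
  proof -
    have row: "(\<Sum>k\<in>K. a k * ((if k = j then 1 else 0) - u * a k * a j)) = a j - u * a j * S"
      using sum_delta_minus_mult[OF fin j, of u a a] by (simp add: S_def mult.commute)
    have "(\<Sum>k\<in>K. U $$ (k, i) * U $$ (k, j))
        = (\<Sum>k\<in>K. ((if k = i then 1 else 0) - u * a k * a i)
                   * ((if k = j then 1 else 0) - u * a k * a j))"
      by (rule sum.cong) (simp_all add: inner i j)
    also have "\<dots> = ((if i = j then 1 else 0) - u * a i * a j) - u * a i * (a j - u * a j * S)"
      by (simp only: row sum_delta_minus_mult[OF fin i, of u a
            "\<lambda>k. (if k = j then 1 else 0) - u * a k * a j"])
    also have "\<dots> = (if i = j then 1 else 0) - u * (1 + (1 - u * S)) * (a i * a j)"
      by (simp add: algebra_simps)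
    \<comment> \<open>As \<open>1 - u S = \<epsilon> a\<^sub>0\<close>, the coefficient is
      \<open>u (1 + \<epsilon> a\<^sub>0) = 1\<close>.\<close>
    also have "u * (1 + (1 - u * S)) = 1"
      unfolding uS using inv by (simp add: mult.commute)
    finally show ?thesis by simp
  qed
  have "U\<^sup>T * U = 1\<^sub>m q"
  proof (rule eq_matI)
    fix i j assume "i < dim_row (1\<^sub>m q :: 'a mat)" and "j < dim_col (1\<^sub>m q :: 'a mat)"
    then have ij: "i < q" "j < q" by simp_all
    have K: "k \<in> K" if "k \<noteq> 0" "k < q" for k
      using that by (simp add: K_def)
    have sym: "(\<Sum>k\<in>K. U $$ (k, 0) * U $$ (k, j)) = (\<Sum>k\<in>K. U $$ (k, j) * U $$ (k, 0))"
      by (simp add: mult.commute)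
    consider "i = 0" "j = 0" | "i = 0" "j \<noteq> 0" | "i \<noteq> 0" "j = 0" | "i \<noteq> 0" "j \<noteq> 0"
      by blast
    then show "(U\<^sup>T * U) $$ (i, j) = 1\<^sub>m q $$ (i, j)"
    proof cases
      case 1
      then show ?thesis using ij by (simp add: gram corner norm)
    next
      case 2
      then show ?thesis using ij by (simp add: gram sym border K)
    next
      case 3
      then show ?thesis using ij by (simp add: gram border K mult.commute[of "a i" "a 0"])
    next
      case 4
      then show ?thesis using ij by (simp add: gram block K)
    qed
  qed (simp_all add: dims)
  then show ?thesis by (simp add: U_def)
qed

end
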